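(* Given a permutation of $[n]$ as a stream, one can decide deterministically in one pass using $O(\log n)$ bits of space whether it is the preorder traversal of some binary search tree. Likewise, one can decide deterministically in one pass using $O(\log n)$ bits of space whether it is the postorder traversal of some binary search tree.
   Context: $[n]=\{1,\dots,n\}$. A binary search tree on $[n]$ is a rooted binary tree (each node has a possibly empty left subtree and a possibly empty right subtree) with $n$ nodes labelled by the elements of $[n]$, each label used once, such that for every node all labels in its left subtree are smaller than its label and all labels in its right subtree are larger. The preorder traversal lists the labels recursively in the order root, left subtree, right subtree; the postorder traversal lists them recursively in the order left subtree, right subtree, root. The tree is not part of the input. Streaming model: the input is promised to be a permutation of $[n]$ ($n$ known in advance), whose values $\pi_1,\dots,\pi_n$ arrive one at a time in this order. A deterministic one-pass algorithm with $s$ bits of space (for given $n$) is a deterministic automaton with at most $2^s$ states: the next state is a function of the current state and the arriving value, and the output is a function of the state reached after the last value. *)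

theory Defs
  imports
    Complex_Main
    "HOL-Library.Tree"
    "HOL-Library.Landau_Symbols"
    "HOL-Combinatorics.Multiset_Permutations"
begin

definition bst_on :: "nat \<Rightarrow> nat tree \<Rightarrow> bool" where
  "bst_on n t \<longleftrightarrow> size t = n \<and> set_tree t = {1..n} \<and> bst t"

definition is_bst_preorder :: "nat \<Rightarrow> nat list \<Rightarrow> bool" where
  "is_bst_preorder n \<pi> \<longleftrightarrow> (\<exists>t. bst_on n t \<and> preorder t = \<pi>)"

definition is_bst_postorder :: "nat \<Rightarrow> nat list \<Rightarrow> bool" where
  "is_bst_postorder n \<pi> \<longleftrightarrow> (\<exists>t. bst_on n t \<and> postorder t = \<pi>)"

record 's streaming_alg =
  states :: "'s set"
  start :: 's
  step :: "'s \<Rightarrow> nat \<Rightarrow> 's"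
  accept :: "'s \<Rightarrow> bool"

definition streaming_alg_bits :: "nat \<Rightarrow> nat \<Rightarrow> 's streaming_alg \<Rightarrow> bool" where
  "streaming_alg_bits n s A \<longleftrightarrow>
     finite (states A) \<and> card (states A) \<le> 2 ^ s \<and> start A \<in> states A \<and>
     (\<forall>q\<in>states A. \<forall>x\<in>{1..n}. step A q x \<in> states A)"

definition run :: "'s streaming_alg \<Rightarrow> nat list \<Rightarrow> bool" where
  "run A \<pi> = accept A (foldl (step A) (start A) \<pi>)"

text \<open>
  The input is promised to be a permutation, so nothing is required on other streams.
\<close>
definition decides :: "nat \<Rightarrow> 's streaming_alg \<Rightarrow> (nat list \<Rightarrow> bool) \<Rightarrow> bool" where
  "decides n A P \<longleftrightarrow> (\<forall>\<pi>\<in>permutations_of_set {1..n}. run A \<pi> \<longleftrightarrow> P \<pi>)"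

text \<open>
  One automaton for each \<open>n\<close>, which is known in advance. Finite state sets embed into
  \<^typ>\<open>nat\<close>, so taking states of type \<^typ>\<open>nat\<close> loses no generality.
\<close>
definition one_pass_decidable ::
  "(nat \<Rightarrow> nat list \<Rightarrow> bool) \<Rightarrow> (nat \<Rightarrow> nat) \<Rightarrow> bool" where
  "one_pass_decidable P s \<longleftrightarrow>
     (\<forall>n. \<exists>A :: nat streaming_alg. streaming_alg_bits n (s n) A \<and> decides n A (P n))"

end

theory Submission
  imports Defs "HOL-Real_Asymp.Real_Asymp"
begin

text \<open>
  Preorders of binary search trees are the permutations avoiding 231, and postorders are those
  avoiding 312. To detect a pattern with counters only, choose a set of active pairs of positions
  \<open>i < j\<close> that contains all inversions and whose non-inversions are exactly pairs witnessing the
  pattern: for 312, \<open>\<pi>\<^sub>j\<close> is at most the prefix maximum at \<open>i\<close>; for 231, \<open>\<pi>\<^sub>i\<close> is at least the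
  suffix minimum at \<open>j\<close>. Over all pairs, add up \<open>2 (\<pi>\<^sub>j - \<pi>\<^sub>i)\<close> if the pair is active, plus
  \<open>\<bar>\<pi>\<^sub>j - \<pi>\<^sub>i\<bar> - (\<pi>\<^sub>j - \<pi>\<^sub>i)\<close>. Inversions and inactive pairs cancel, so the sum is nonnegative, and it
  vanishes iff the pattern is avoided. Because the input is a permutation of \<open>{1..n}\<close>, the sum of
  the \<open>\<bar>\<pi>\<^sub>j - \<pi>\<^sub>i\<bar>\<close> is a constant, and the values above a prefix maximum or below a
  suffix minimum lie on a known side of the position, so the sum over active pairs depends only on
  positions, values, prefix sums and these extrema.

  Suffix minima lie in the future, but if the bottoms of the maximal descending runs
  increase, the suffix minimum at a position is the bottom of its run; if they do not increase,
  there is a 231 and the input can be rejected at once.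
\<close>

section \<open>Binary search trees and pattern avoidance\<close>

text \<open>The relation is a parameter so that \<open>(>)\<close> on the reversed list expresses
  312-avoidance for postorders.\<close>

definition avoids_231_wrt :: "('a \<Rightarrow> 'a \<Rightarrow> bool) \<Rightarrow> 'a list \<Rightarrow> bool" where
  "avoids_231_wrt R xs \<longleftrightarrow>
     (\<forall>i j k. i < j \<longrightarrow> j < k \<longrightarrow> k < length xs \<longrightarrow> \<not> (R (xs ! k) (xs ! i) \<and> R (xs ! i) (xs ! j)))"

text \<open>Peels off the first entry as the 2 of a possible pattern, just as a preorder starts with
  its root.\<close>

fun avoids_231_rec :: "('a \<Rightarrow> 'a \<Rightarrow> bool) \<Rightarrow> 'a list \<Rightarrow> bool" where
  "avoids_231_rec R [] = True"
| "avoids_231_rec R (x # xs) \<longleftrightarrow> sorted_wrt (\<lambda>y z. \<not> (R z x \<and> R x y)) xs \<and> avoids_231_rec R xs"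

lemma avoids_231_rec_iff: "avoids_231_rec R xs \<longleftrightarrow> avoids_231_wrt R xs"
proof (induction xs)
  case Nil
  show ?case by (simp add: avoids_231_wrt_def)
next
  case (Cons x xs)
  have "avoids_231_wrt R (x # xs) \<longleftrightarrow>
      sorted_wrt (\<lambda>y z. \<not> (R z x \<and> R x y)) xs \<and> avoids_231_wrt R xs" (is "?l \<longleftrightarrow> ?r")
  proof
    assume l: ?l
    have "\<not> (R (xs ! k) x \<and> R x (xs ! j))" if "j < k" "k < length xs" for j k
      using l[unfolded avoids_231_wrt_def, rule_format, of 0 "Suc j" "Suc k"] that by simp
    moreover have "\<not> (R (xs ! k) (xs ! i) \<and> R (xs ! i) (xs ! j))"
      if "i < j" "j < k" "k < length xs" for i j k
      using l[unfolded avoids_231_wrt_def, rule_format, of "Suc i" "Suc j" "Suc k"] that by simp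
    ultimately show ?r unfolding avoids_231_wrt_def sorted_wrt_iff_nth_less by blast
  next
    assume r: ?r
    show ?l unfolding avoids_231_wrt_def
    proof (intro allI impI)
      fix i j k assume *: "i < j" "j < k" "k < length (x # xs)"
      obtain j' where j': "j = Suc j'" using * by (cases j) auto
      obtain k' where k': "k = Suc k'" using * by (cases k) auto
      show "\<not> (R ((x # xs) ! k) ((x # xs) ! i) \<and> R ((x # xs) ! i) ((x # xs) ! j))"
        using * j' k' r by (cases i) (auto simp: avoids_231_wrt_def sorted_wrt_iff_nth_less)
    qed
  qed
  then show ?case using Cons.IH by simp
qed

lemma avoids_231_rec_append:
  "avoids_231_rec R (xs @ ys) \<Longrightarrow> avoids_231_rec R xs \<and> avoids_231_rec R ys"
  by (induction xs) (auto simp: sorted_wrt_append)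

lemma sorted_wrtI: "(\<And>y z. y \<in> set xs \<Longrightarrow> z \<in> set xs \<Longrightarrow> R y z) \<Longrightarrow> sorted_wrt R xs"
  by (induction xs) auto

lemma avoids_231_rec_append_less:
  assumes "avoids_231_rec R xs" "avoids_231_rec R ys"
    and "\<And>x y. x \<in> set xs \<Longrightarrow> y \<in> set ys \<Longrightarrow> \<not> R y x"
  shows "avoids_231_rec R (xs @ ys)"
  using assms by (induction xs) (auto simp: sorted_wrt_append intro!: sorted_wrtI)

text \<open>With the root as the 2, the smaller keys on the left all precede the larger ones on the
  right. No pattern straddles the subtrees, since its last entry would be a right key below a left
  key.\<close>

lemma avoids_231_rec_preorder:
  assumes "transp R" "asymp R" "bst_wrt R t"
  shows "avoids_231_rec R (preorder t)"
  using assms(3)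
proof (induction t)
  case (Node l a r)
  have lr: "\<not> R y x" if "x \<in> set_tree l" "y \<in> set_tree r" for x y
    using Node.prems that assms(1,2) by simp (meson asympD transpE)
  have "sorted_wrt (\<lambda>y z. \<not> (R z a \<and> R a y)) (preorder l @ preorder r)"
    unfolding sorted_wrt_append
    using Node.prems assms(2) by (auto intro!: sorted_wrtI dest: asympD)
  then show ?case using Node lr by (auto intro!: avoids_231_rec_append_less)
qed simp

text \<open>With \<open>x\<close> as the 2, no entry above \<open>x\<close> may precede one below
  it, so the entries below form an initial segment.\<close>

lemma split_at_pivot:
  assumes "sorted_wrt (\<lambda>y z. \<not> (R z x \<and> R x y)) xs" "asymp R"
    and "\<And>y. y \<in> set xs \<Longrightarrow> R y x \<or> R x y"
  shows "\<exists>ys zs. xs = ys @ zs \<and> (\<forall>y\<in>set ys. R y x) \<and> (\<forall>z\<in>set zs. R x z)"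
  using assms(1,3)
proof (induction xs)
  case (Cons a xs)
  show ?case
  proof (cases "R a x")
    case True
    from Cons obtain ys zs where "xs = ys @ zs" "\<forall>y\<in>set ys. R y x" "\<forall>z\<in>set zs. R x z" by auto
    with True show ?thesis by (intro exI[of _ "a # ys"] exI[of _ zs]) auto
  next
    case False
    then have "\<forall>z\<in>set (a # xs). R x z" using Cons.prems by auto
    then show ?thesis by (intro exI[of _ "[]"] exI[of _ "a # xs"]) auto
  qed
qed simp

text \<open>The head becomes the root, and \<open>split_at_pivot\<close> cuts the tail into the
  preorders of the two subtrees, which are built recursively.\<close>

lemma ex_bst_preorder:
  assumes "totalp R" "asymp R" "distinct xs" "avoids_231_rec R xs"
  shows "\<exists>t. bst_wrt R t \<and> preorder t = xs"
  using assms(3,4)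
proof (induction xs rule: length_induct)
  case (1 xs)
  show ?case
  proof (cases xs)
    case Nil
    then show ?thesis by (intro exI[of _ Leaf]) simp
  next
    case (Cons x xs')
    have "R y x \<or> R x y" if "y \<in> set xs'" for y
      using 1(2) Cons that assms(1) by (metis distinct.simps(2) totalpD)
    then obtain ys zs where yz: "xs' = ys @ zs" "\<forall>y\<in>set ys. R y x" "\<forall>z\<in>set zs. R x z"
      using split_at_pivot[of R x xs'] 1(3) Cons assms(2) by auto
    have "avoids_231_rec R ys \<and> avoids_231_rec R zs"
      using 1(3) Cons yz(1) by (auto dest: avoids_231_rec_append)
    then obtain l r where "bst_wrt R l" "preorder l = ys" "bst_wrt R r" "preorder r = zs"
      using 1(1)[rule_format, of ys] 1(1)[rule_format, of zs] 1(2) Cons yz(1) by auto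
    then show ?thesis using Cons yz
      by (intro exI[of _ "Node l x r"]) (auto simp flip: set_preorder)
  qed
qed

lemma ex_bst_preorder_iff:
  assumes "transp R" "totalp R" "asymp R" "distinct xs"
  shows "(\<exists>t. bst_wrt R t \<and> preorder t = xs) \<longleftrightarrow> avoids_231_wrt R xs"
  using ex_bst_preorder[OF assms(2-4)] avoids_231_rec_preorder[OF assms(1,3)]
  by (auto simp: avoids_231_rec_iff)

lemma preorder_mirror: "preorder (mirror t) = rev (postorder t)"
  by (induction t) auto

lemma postorder_mirror: "postorder (mirror t) = rev (preorder t)"
  by (induction t) auto

lemma set_tree_mirror: "set_tree (mirror t) = set_tree t"
  by (induction t) auto

lemma bst_wrt_mirror: "bst_wrt R (mirror t) = bst_wrt (\<lambda>x y. R y x) t"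
  by (induction t) (auto simp: set_tree_mirror)

lemma is_bst_preorder_iff:
  assumes "xs \<in> permutations_of_set {1..n}"
  shows "is_bst_preorder n xs \<longleftrightarrow> avoids_231_wrt (<) xs"
proof -
  have xs: "set xs = {1..n}" "distinct xs" using assms by (auto dest: permutations_of_setD)
  have "bst_on n t" if "bst t" "preorder t = xs" for t
    using that xs distinct_card[OF xs(2)] unfolding bst_on_def
    by (metis card_atLeastAtMost diff_Suc_1 length_preorder set_preorder)
  then have "is_bst_preorder n xs \<longleftrightarrow> (\<exists>t. bst_wrt (<) t \<and> preorder t = xs)"
    unfolding is_bst_preorder_def by (auto simp: bst_on_def)
  also have "\<dots> \<longleftrightarrow> avoids_231_wrt (<) xs"
    by (rule ex_bst_preorder_iff) (use xs in auto)
  finally show ?thesis .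
qed

text \<open>The reversed postorder is the preorder of the mirrored tree, which is a search tree for
  \<open>(>)\<close>.\<close>

lemma is_bst_postorder_iff:
  assumes "xs \<in> permutations_of_set {1..n}"
  shows "is_bst_postorder n xs \<longleftrightarrow> avoids_231_wrt (>) (rev xs)"
proof -
  have xs: "set xs = {1..n}" "distinct xs" using assms by (auto dest: permutations_of_setD)
  have "bst_on n t" if "bst t" "postorder t = xs" for t
    using that xs distinct_card[OF xs(2)] unfolding bst_on_def
    by (metis card_atLeastAtMost diff_Suc_1 length_postorder set_postorder)
  then have "is_bst_postorder n xs \<longleftrightarrow> (\<exists>t. bst_wrt (<) t \<and> postorder t = xs)"
    unfolding is_bst_postorder_def by (auto simp: bst_on_def)
  also have "\<dots> \<longleftrightarrow> (\<exists>t. bst_wrt (>) t \<and> preorder t = rev xs)"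
  proof safe
    fix t assume "bst t" "xs = postorder t"
    then show "\<exists>t'. bst_wrt (>) t' \<and> preorder t' = rev (postorder t)"
      by (intro exI[of _ "mirror t"]) (simp add: bst_wrt_mirror preorder_mirror)
  next
    fix t :: "nat tree" assume "bst_wrt (>) t" "preorder t = rev xs"
    then show "\<exists>t'. bst t' \<and> postorder t' = xs"
      by (intro exI[of _ "mirror t"]) (simp add: bst_wrt_mirror postorder_mirror)
  qed
  also have "\<dots> \<longleftrightarrow> avoids_231_wrt (>) (rev xs)"
    by (rule ex_bst_preorder_iff) (use xs in auto)
  finally show ?thesis .
qed

lemma avoids_231_rev_iff:
  "avoids_231_wrt (>) (rev xs) \<longleftrightarrow>
     (\<forall>i j k. i < j \<longrightarrow> j < k \<longrightarrow> k < length xs \<longrightarrow> \<not> (xs ! j < xs ! k \<and> xs ! k < xs ! i))"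
  (is "?l \<longleftrightarrow> ?r")
proof
  assume l: ?l
  show ?r
  proof (intro allI impI)
    fix i j k assume "i < j" "j < k" "k < length xs"
    moreover from this have "length xs - Suc k < length xs - Suc j"
      "length xs - Suc j < length xs - Suc i" "length xs - Suc i < length xs" by linarith+
    ultimately show "\<not> (xs ! j < xs ! k \<and> xs ! k < xs ! i)"
      using l[unfolded avoids_231_wrt_def, rule_format,
          of "length xs - Suc k" "length xs - Suc j" "length xs - Suc i"]
      by (auto simp: rev_nth)
  qed
next
  assume r: ?r
  show ?l unfolding avoids_231_wrt_def
  proof (intro allI impI)
    fix i j k assume "i < j" "j < k" "k < length (rev xs)"
    moreover from this have "length xs - Suc k < length xs - Suc j"
      "length xs - Suc j < length xs - Suc i" "length xs - Suc i < length xs" unfolding length_rev by linarith+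
    ultimately show "\<not> (rev xs ! i < rev xs ! k \<and> rev xs ! j < rev xs ! i)"
      using r[rule_format, of "length xs - Suc k" "length xs - Suc j" "length xs - Suc i"]
      by (auto simp: rev_nth)
  qed
qed

section \<open>From polynomially many states to logarithmic space\<close>

text \<open>Allows automata over any convenient state type: \<open>Inv\<close> links the prefix read
  so far to the state, and the polynomially many states are numbered by naturals. \<open>f\<close>
  and \<open>q0\<close> are the same for all \<open>n\<close>; the acceptance test may depend on
  it.\<close>

lemma one_pass_decidableI:
  fixes S :: "nat \<Rightarrow> 's set" and Inv :: "nat \<Rightarrow> nat list \<Rightarrow> 's \<Rightarrow> bool"
  assumes fin: "\<And>n. finite (S n)"
    and card: "\<And>n. card (S n) \<le> C * (n + 1) ^ k"
    and inS: "\<And>n ys q. Inv n ys q \<Longrightarrow> distinct ys \<Longrightarrow> set ys \<subseteq> {1..n} \<Longrightarrow> q \<in> S n"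
    and init: "\<And>n. Inv n [] q0"
    and step: "\<And>n ys q x. Inv n ys q \<Longrightarrow> distinct (ys @ [x]) \<Longrightarrow> set (ys @ [x]) \<subseteq> {1..n} \<Longrightarrow>
                Inv n (ys @ [x]) (f q x)"
    and acc: "\<And>n xs q. Inv n xs q \<Longrightarrow> xs \<in> permutations_of_set {1..n} \<Longrightarrow> acc n q \<longleftrightarrow> P n xs"
  shows "\<exists>s :: nat \<Rightarrow> nat. (\<lambda>n. real (s n)) \<in> O(\<lambda>n. log 2 (real n)) \<and> one_pass_decidable P s"
proof -
  define s where "s n = nat \<lceil>log 2 (real (C * (n + 1) ^ k))\<rceil>" for n
  have q0: "q0 \<in> S n" for n using inS[OF init] by simp
  have C: "C > 0"
    using card[of 0] q0[of 0] fin[of 0] by (cases C) auto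
  have s_bound: "C * (n + 1) ^ k \<le> 2 ^ s n" for n
  proof -
    have "real (C * (n + 1) ^ k) = 2 powr log 2 (real (C * (n + 1) ^ k))"
      using C by simp
    also have "\<dots> \<le> 2 powr real (s n)"
      unfolding s_def by (intro powr_mono) linarith+
    also have "\<dots> = real (2 ^ s n)" by (simp add: powr_realpow)
    finally show ?thesis by linarith
  qed
  have "(\<lambda>n. real (s n)) \<in> O(\<lambda>n. \<bar>log 2 C\<bar> + real k * log 2 (real n + 1) + 1)"
  proof (rule landau_o.big_mono, rule always_eventually, rule allI)
    fix n
    have "log 2 (real (C * (n + 1) ^ k)) = log 2 C + real k * log 2 (real n + 1)"
      using C by (simp add: log_mult log_nat_power add.commute)
    moreover have "log 2 (real n + 1) \<ge> 0" by simp
    then have "real k * log 2 (real n + 1) \<ge> 0" by simp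
    ultimately show "norm (real (s n)) \<le> norm (\<bar>log 2 C\<bar> + real k * log 2 (real n + 1) + 1)"
      unfolding s_def real_norm_def by linarith
  qed
  also have "(\<lambda>n. \<bar>log 2 C\<bar> + real k * log 2 (real n + 1) + 1) \<in> O(\<lambda>n. log 2 (real n))"
  proof (intro sum_in_bigo)
    show one: "(\<lambda>n::nat. 1::real) \<in> O(\<lambda>n. log 2 (real n))" by real_asymp
    have "(\<lambda>n::nat. \<bar>log 2 C\<bar>) \<in> O(\<lambda>n. 1)" by (rule bigo_const)
    from landau_o.big_trans[OF this one] show "(\<lambda>n::nat. \<bar>log 2 C\<bar>) \<in> O(\<lambda>n. log 2 (real n))" .
    have "(\<lambda>n::nat. log 2 (real n + 1)) \<in> O(\<lambda>n. log 2 (real n))" by real_asymp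
    then show "(\<lambda>n::nat. real k * log 2 (real n + 1)) \<in> O(\<lambda>n. log 2 (real n))"
      by (cases "k = 0") auto
  qed
  finally have "(\<lambda>n. real (s n)) \<in> O(\<lambda>n. log 2 (real n))" .
  moreover have "one_pass_decidable P s"
    unfolding one_pass_decidable_def
  proof
    fix n
    obtain h where h: "bij_betw h (S n) {0..<card (S n)}"
      using ex_bij_betw_finite_nat[OF fin[of n]] by blast
    define g where "g = inv_into (S n) h"
    have gh: "g (h q) = q" if "q \<in> S n" for q
      using h that unfolding g_def by (simp add: bij_betw_def)
    have hS: "h q < card (S n)" if "q \<in> S n" for q
      using h that by (auto simp: bij_betw_def)
    \<comment> \<open>Only states satisfying \<open>Inv\<close> for some valid prefix are known to
      stay in \<open>S n\<close> under \<open>f\<close>. Any transition leaving \<open>S n\<close>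
      is redirected to the start state, so that \<open>states\<close> is closed.\<close>
    define A :: "nat streaming_alg" where
      "A = \<lparr>states = {0..<card (S n)}, start = h q0,
            step = (\<lambda>a x. if f (g a) x \<in> S n then h (f (g a) x) else h q0),
            accept = (\<lambda>a. acc n (g a))\<rparr>"
    have "streaming_alg_bits n (s n) A"
      using order_trans[OF card s_bound] hS q0 by (auto simp: streaming_alg_bits_def A_def)
    moreover have "decides n A (P n)"
      unfolding decides_def
    proof
      fix xs assume xs: "xs \<in> permutations_of_set {1..n}"
      have "\<exists>q. Inv n ys q \<and> foldl (streaming_alg.step A) (start A) ys = h q"
        if "distinct ys" "set ys \<subseteq> {1..n}" for ys
        using that
      proof (induction ys rule: rev_induct)
        case Nil
        show ?case using init by (auto simp: A_def)
      next
        case (snoc x ys)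
        then obtain q where q: "Inv n ys q" "foldl (streaming_alg.step A) (start A) ys = h q"
          by auto
        have "q \<in> S n" using inS[OF q(1)] snoc.prems by simp
        moreover have "Inv n (ys @ [x]) (f q x)" using step[OF q(1) snoc.prems] .
        moreover from this have "f q x \<in> S n" using inS snoc.prems by blast
        ultimately show ?case using q(2) by (intro exI[of _ "f q x"]) (simp add: A_def gh)
      qed
      then obtain q where q: "Inv n xs q" "foldl (streaming_alg.step A) (start A) xs = h q"
        using permutations_of_setD[OF xs] by auto
      moreover have "q \<in> S n" using inS[OF q(1)] permutations_of_setD[OF xs] by simp
      ultimately show "run A xs \<longleftrightarrow> P n xs"
        using acc[OF q(1) xs] by (simp add: run_def A_def gh)
    qed
    ultimately show "\<exists>A :: nat streaming_alg. streaming_alg_bits n (s n) A \<and> decides n A (P n)"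
      by blast
  qed
  ultimately show ?thesis by blast
qed

section \<open>The weight over pairs of positions\<close>

lemma sum_pairs_symmetric:
  fixes g :: "nat \<Rightarrow> nat \<Rightarrow> int"
  assumes "\<And>i j. g i j = g j i" "\<And>i. g i i = 0"
  shows "(\<Sum>i<n. \<Sum>j<n. g i j) = 2 * (\<Sum>j<n. \<Sum>i<j. g i j)"
proof (induction n)
  case (Suc n)
  have "(\<Sum>i<Suc n. \<Sum>j<Suc n. g i j) =
      (\<Sum>i<n. \<Sum>j<n. g i j) + (\<Sum>i<n. g i n) + (\<Sum>j<n. g n j)"
    using assms(2) by (simp add: sum.distrib)
  also have "(\<Sum>j<n. g n j) = (\<Sum>i<n. g i n)" using assms(1) by simp
  finally show ?case using Suc.IH by simp
qed simp

text \<open>Ranges over ordered pairs, so it is twice the sum over \<open>i < j\<close>; hence the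
  acceptance tests double the weight.\<close>

definition total_distance :: "nat \<Rightarrow> int" where
  "total_distance n = (\<Sum>a\<in>{1..n}. \<Sum>b\<in>{1..n}. \<bar>int b - int a\<bar>)"

lemma sum_distance_permutation:
  assumes "xs \<in> permutations_of_set {1..n}"
  shows "2 * (\<Sum>j<n. \<Sum>i<j. \<bar>int (xs ! j) - int (xs ! i)\<bar>) = total_distance n"
proof -
  have xs: "set xs = {1..n}" "distinct xs" using assms by (auto dest: permutations_of_setD)
  then have "length xs = n" using distinct_card by fastforce
  then have bij: "bij_betw ((!) xs) {..<n} {1..n}"
    using bij_betw_nth[OF xs(2), of "{..<n}" "{1..n}"] xs by auto
  have "total_distance n = (\<Sum>i<n. \<Sum>j<n. \<bar>int (xs ! j) - int (xs ! i)\<bar>)"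
    unfolding total_distance_def by (simp only: sum.reindex_bij_betw[OF bij, symmetric])
  also have "\<dots> = 2 * (\<Sum>j<n. \<Sum>i<j. \<bar>int (xs ! j) - int (xs ! i)\<bar>)"
    by (rule sum_pairs_symmetric) auto
  finally show ?thesis by simp
qed

text \<open>Let \<open>d = p j - p i\<close>. An active inversion contributes
  \<open>2 * d - d + \<bar>d\<bar> = 0\<close>. An inactive pair has \<open>d \<ge> 0\<close> by the
  second assumption and contributes \<open>- d + \<bar>d\<bar> = 0\<close>. What survives is
  \<open>2 * d\<close> for each active non-inversion. Injectivity makes the resulting comparison
  strict.\<close>

lemma pair_weight_eq_0_iff:
  fixes p :: "nat \<Rightarrow> int" and A :: "nat \<Rightarrow> nat \<Rightarrow> bool"
  assumes "inj_on p {..<n}" "\<And>i j. i < j \<Longrightarrow> j < n \<Longrightarrow> p j < p i \<Longrightarrow> A i j"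
  shows "2 * (\<Sum>j<n. \<Sum>i<j. if A i j then p j - p i else 0) - (\<Sum>j<n. \<Sum>i<j. p j - p i)
           + (\<Sum>j<n. \<Sum>i<j. \<bar>p j - p i\<bar>) = 0
         \<longleftrightarrow> (\<forall>i j. i < j \<longrightarrow> j < n \<longrightarrow> A i j \<longrightarrow> p j < p i)" (is "?w = 0 \<longleftrightarrow> ?r")
proof -
  define v where "v i j = (if A i j \<and> p i < p j then 2 * (p j - p i) else 0)" for i j
  have v0: "v i j \<ge> 0" for i j by (simp add: v_def)
  have "?w = (\<Sum>j<n. \<Sum>i<j. 2 * (if A i j then p j - p i else 0) - (p j - p i) + \<bar>p j - p i\<bar>)"
    by (simp add: sum.distrib sum_subtractf sum_distrib_left)
  also have "\<dots> = (\<Sum>j<n. \<Sum>i<j. v i j)"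
    using assms(2) by (intro sum.cong refl) (force simp: v_def)
  also have "\<dots> = 0 \<longleftrightarrow> (\<forall>j<n. \<forall>i<j. v i j = 0)"
    using v0 by (auto simp: sum_nonneg_eq_0_iff sum_nonneg)
  also have "\<dots> \<longleftrightarrow> (\<forall>i j. i < j \<longrightarrow> j < n \<longrightarrow> A i j \<longrightarrow> p j \<le> p i)"
  proof -
    have "v i j = 0 \<longleftrightarrow> (A i j \<longrightarrow> p j \<le> p i)" for i j by (auto simp: v_def)
    then show ?thesis by blast
  qed
  also have "\<dots> \<longleftrightarrow> ?r"
  proof -
    have "p j \<noteq> p i" if "i < j" "j < n" for i j
      using inj_onD[OF assms(1), of j i] that by auto
    then show ?thesis by (auto simp: less_le)
  qed
  finally show ?thesis .
qed

lemma sum_pairs_diff: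
  fixes p :: "nat \<Rightarrow> int"
  shows "(\<Sum>j<n. \<Sum>i<j. p j - p i) = (\<Sum>j<n. int j * p j - (\<Sum>i<j. p i))"
  by (simp add: sum_subtractf)

text \<open>Prefix maxima belong to the earlier index of a pair, so the postorder weight groups the
  pairs by \<open>i\<close> instead of \<open>j\<close>.\<close>

lemma sum_pairs_swap:
  fixes g :: "nat \<Rightarrow> nat \<Rightarrow> int"
  shows "(\<Sum>j<n. \<Sum>i<j. g i j) = (\<Sum>i<n. \<Sum>j\<in>{i<..<n}. g i j)"
proof (induction n)
  case (Suc n)
  have "{i<..<Suc n} = insert n {i<..<n}" if "i < n" for i using that by auto
  then have "(\<Sum>i<n. \<Sum>j\<in>{i<..<Suc n}. g i j) = (\<Sum>i<n. g i n + (\<Sum>j\<in>{i<..<n}. g i j))"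
    by (intro sum.cong refl) simp
  moreover have "{n<..<Suc n} = {}" by auto
  ultimately show ?case using Suc.IH by (simp add: sum.distrib)
qed simp

lemma sum_int_atLeast1: "2 * (\<Sum>v\<in>{1..M::nat}. int v) = int M * (int M + 1)"
  by (induction M) (auto simp: algebra_simps)

section \<open>Evaluating the weight position by position\<close>

definition prefix_max :: "nat list \<Rightarrow> nat \<Rightarrow> nat" where
  "prefix_max xs i = Max (set (take (Suc i) xs))"

definition suffix_min :: "nat list \<Rightarrow> nat \<Rightarrow> nat" where
  "suffix_min xs j = Min (set (drop j xs))"

lemma nth_in_set_take: "i < k \<Longrightarrow> i < length xs \<Longrightarrow> xs ! i \<in> set (take k xs)"
  by (auto simp: in_set_conv_nth intro!: exI[of _ i])

lemma nth_in_set_drop: "k \<le> i \<Longrightarrow> i < length xs \<Longrightarrow> xs ! i \<in> set (drop k xs)"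
  by (auto simp: in_set_conv_nth intro!: exI[of _ "i - k"])

lemma prefix_max_ge: "k \<le> i \<Longrightarrow> k < length xs \<Longrightarrow> xs ! k \<le> prefix_max xs i"
  unfolding prefix_max_def by (intro Max_ge) (auto intro: nth_in_set_take)

lemma prefix_max_attained: "i < length xs \<Longrightarrow> \<exists>k\<le>i. prefix_max xs i = xs ! k"
proof -
  assume i: "i < length xs"
  then have "prefix_max xs i \<in> set (take (Suc i) xs)"
    unfolding prefix_max_def by (intro Max_in) auto
  then show ?thesis by (auto simp: in_set_conv_nth less_Suc_eq_le)
qed

lemma suffix_min_le: "j \<le> k \<Longrightarrow> k < length xs \<Longrightarrow> suffix_min xs j \<le> xs ! k"
  unfolding suffix_min_def by (intro Min_le) (auto intro: nth_in_set_drop)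

lemma suffix_min_attained: "j < length xs \<Longrightarrow> \<exists>k. j \<le> k \<and> k < length xs \<and> suffix_min xs j = xs ! k"
proof -
  assume j: "j < length xs"
  then have "suffix_min xs j \<in> set (drop j xs)"
    unfolding suffix_min_def by (intro Min_in) auto
  then obtain i where "i < length (drop j xs)" "suffix_min xs j = drop j xs ! i"
    by (auto simp: in_set_conv_nth)
  then show ?thesis using j by (intro exI[of _ "j + i"]) auto
qed

text \<open>
  The contributions of one position to the weight, where \<open>t\<close> values with sum \<open>P\<close> precede the value
  \<open>x\<close>, and \<open>M\<close> or \<open>m\<close> is its prefix maximum or suffix minimum. The last summand
  \<open>t * x - P\<close> is the sum of the \<open>\<pi>\<^sub>j - \<pi>\<^sub>i\<close> over all \<open>i < j\<close>.
\<close>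

definition post_term :: "int \<Rightarrow> int \<Rightarrow> int \<Rightarrow> int \<Rightarrow> int" where
  "post_term t P M x = M * (M + 1) - 2 * (P + x) - 2 * (M - t - 1) * x - (t * x - P)"

definition pre_term :: "int \<Rightarrow> int \<Rightarrow> int \<Rightarrow> int \<Rightarrow> int" where
  "pre_term t P m x = 2 * (t - m + 1) * x - 2 * P + m * (m - 1) - (t * x - P)"

definition post_weight :: "nat list \<Rightarrow> int" where
  "post_weight xs = (\<Sum>i<length xs. post_term i (\<Sum>k<i. int (xs ! k)) (prefix_max xs i) (int (xs ! i)))"

definition pre_weight :: "nat list \<Rightarrow> int" where
  "pre_weight xs = (\<Sum>i<length xs. pre_term i (\<Sum>k<i. int (xs ! k)) (suffix_min xs i) (int (xs ! i)))"

text \<open>The positions up to \<open>i\<close> and the active ones after it together carry exactly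
  the values \<open>{1..M}\<close>, where \<open>M\<close> is the prefix maximum; subtracting the
  prefix leaves the active sum. The factor 2 clears the denominator of the triangular
  number.\<close>

lemma post_active_sum:
  assumes xs: "xs \<in> permutations_of_set {1..n}" and i: "i < n"
  shows "2 * (\<Sum>j\<in>{i<..<n}. if xs ! j \<le> prefix_max xs i then int (xs ! j) - int (xs ! i) else 0) =
    int (prefix_max xs i) * (int (prefix_max xs i) + 1) - 2 * (\<Sum>k\<le>i. int (xs ! k))
      - 2 * (int (prefix_max xs i) - int i - 1) * int (xs ! i)"
proof -
  define M where "M = prefix_max xs i"
  have s: "set xs = {1..n}" "distinct xs" using xs by (auto dest: permutations_of_setD)
  have len: "length xs = n" using distinct_card[OF s(2)] s(1) by simp
  have inj: "inj_on ((!) xs) {..<n}" using inj_on_nth[OF s(2)] len by auto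
  have img: "(!) xs ` {..<n} = {1..n}" using s(1) len by (auto simp: set_conv_nth)
  have Mn: "M \<le> n"
    using prefix_max_attained[of i xs] i len s(1) M_def by (metis atLeastAtMost_iff le_less_trans nth_mem)
  define U where "U = {j\<in>{i<..<n}. xs ! j \<le> M}"
  have disj: "U \<inter> {..i} = {}" by (auto simp: U_def)
  have "(!) xs ` (U \<union> {..i}) = {1..M}"
  proof
    show "(!) xs ` (U \<union> {..i}) \<subseteq> {1..M}"
      using s(1) len i prefix_max_ge[of _ i xs] nth_mem[of _ xs] by (fastforce simp: U_def M_def)
    show "{1..M} \<subseteq> (!) xs ` (U \<union> {..i})"
    proof
      fix v assume v: "v \<in> {1..M}"
      then have "v \<in> (!) xs ` {..<n}" unfolding img using Mn by simp
      then obtain k where "k < n" "v = xs ! k" by auto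
      then show "v \<in> (!) xs ` (U \<union> {..i})" using v by (cases "k \<le> i") (auto simp: U_def)
    qed
  qed
  moreover have "inj_on ((!) xs) (U \<union> {..i})"
    by (rule inj_on_subset[OF inj]) (use i in \<open>auto simp: U_def\<close>)
  ultimately have "(\<Sum>k\<in>U \<union> {..i}. int (xs ! k) - int (xs ! i)) = (\<Sum>v\<in>{1..M}. int v - int (xs ! i))"
    using sum.reindex[of "(!) xs" "U \<union> {..i}" "\<lambda>v. int v - int (xs ! i)"] by simp
  then have "(\<Sum>k\<in>U. int (xs ! k) - int (xs ! i)) =
      (\<Sum>v\<in>{1..M}. int v - int (xs ! i)) - (\<Sum>k\<le>i. int (xs ! k) - int (xs ! i))"
    using sum.union_disjoint[OF _ _ disj, of "\<lambda>k. int (xs ! k) - int (xs ! i)"] by (simp add: U_def)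
  moreover have "(\<Sum>k\<in>U. int (xs ! k) - int (xs ! i)) =
      (\<Sum>j\<in>{i<..<n}. if xs ! j \<le> M then int (xs ! j) - int (xs ! i) else 0)"
    unfolding U_def by (rule sum.inter_filter) simp
  ultimately show ?thesis
    using sum_int_atLeast1[of M] unfolding M_def[symmetric]
    by (simp add: sum_subtractf algebra_simps)
qed

text \<open>Values below the suffix minimum \<open>m\<close> can only occur before \<open>j\<close>,
  so the inactive positions carry exactly \<open>{1..m - 1}\<close>; they are subtracted from the
  sum over all \<open>i < j\<close>.\<close>

lemma pre_active_sum:
  assumes xs: "xs \<in> permutations_of_set {1..n}" and j: "j < n"
  shows "2 * (\<Sum>i<j. if suffix_min xs j \<le> xs ! i then int (xs ! j) - int (xs ! i) else 0) =
    2 * (int j - int (suffix_min xs j) + 1) * int (xs ! j) - 2 * (\<Sum>k<j. int (xs ! k))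
      + int (suffix_min xs j) * (int (suffix_min xs j) - 1)"
proof -
  define m where "m = suffix_min xs j"
  have s: "set xs = {1..n}" "distinct xs" using xs by (auto dest: permutations_of_setD)
  have len: "length xs = n" using distinct_card[OF s(2)] s(1) by simp
  have inj: "inj_on ((!) xs) {..<n}" using inj_on_nth[OF s(2)] len by auto
  have img: "(!) xs ` {..<n} = {1..n}" using s(1) len by (auto simp: set_conv_nth)
  have mn: "1 \<le> m" "m \<le> n"
    using suffix_min_attained[of j xs] j len s(1) nth_mem[of _ xs] by (auto simp: m_def)
  define U where "U = {i\<in>{..<j}. m \<le> xs ! i}"
  define L where "L = {i\<in>{..<j}. \<not> m \<le> xs ! i}"
  have UL: "{..<j} = U \<union> L" "U \<inter> L = {}" by (auto simp: U_def L_def)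
  have "(!) xs ` L = {1..m - 1}"
  proof
    show "(!) xs ` L \<subseteq> {1..m - 1}"
      using s(1) len j nth_mem[of _ xs] by (fastforce simp: L_def)
    show "{1..m - 1} \<subseteq> (!) xs ` L"
    proof
      fix v assume v: "v \<in> {1..m - 1}"
      then have "v \<in> (!) xs ` {..<n}" unfolding img using mn by auto
      then obtain k where k: "k < n" "v = xs ! k" by auto
      then have "k < j" using suffix_min_le[of j k xs] len v mn by (fastforce simp: m_def not_less[symmetric])
      then show "v \<in> (!) xs ` L" using v k mn by (auto simp: L_def)
    qed
  qed
  moreover have "inj_on ((!) xs) L"
    by (rule inj_on_subset[OF inj]) (use j in \<open>auto simp: L_def\<close>)
  ultimately have "(\<Sum>k\<in>L. int (xs ! j) - int (xs ! k)) = (\<Sum>v\<in>{1..m - 1}. int (xs ! j) - int v)"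
    using sum.reindex[of "(!) xs" L "\<lambda>v. int (xs ! j) - int v"] by simp
  then have "(\<Sum>k\<in>U. int (xs ! j) - int (xs ! k)) =
      (\<Sum>k<j. int (xs ! j) - int (xs ! k)) - (\<Sum>v\<in>{1..m - 1}. int (xs ! j) - int v)"
    unfolding UL(1)
    using sum.union_disjoint[OF _ _ UL(2), of "\<lambda>k. int (xs ! j) - int (xs ! k)"]
    by (simp add: U_def L_def)
  moreover have "(\<Sum>k\<in>U. int (xs ! j) - int (xs ! k)) =
      (\<Sum>i<j. if m \<le> xs ! i then int (xs ! j) - int (xs ! i) else 0)"
    unfolding U_def by (rule sum.inter_filter) simp
  ultimately show ?thesis
    using sum_int_atLeast1[of "m - 1"] mn unfolding m_def[symmetric]
    by (simp add: sum_subtractf algebra_simps of_nat_diff)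
qed

section \<open>Vanishing of the weight and the patterns\<close>

text \<open>A 312 at \<open>i < j < k\<close> makes \<open>(j, k)\<close> an active non-inversion,
  since the prefix maximum at \<open>j\<close> is at least \<open>xs ! i\<close>. Conversely, an
  active non-inversion supplies the 1 and the 2, and the position of the prefix maximum supplies the
  3.\<close>

lemma post_weight_correct:
  assumes xs: "xs \<in> permutations_of_set {1..n}"
  shows "2 * post_weight xs + total_distance n = 0 \<longleftrightarrow> avoids_231_wrt (>) (rev xs)"
proof -
  have s: "set xs = {1..n}" "distinct xs" using xs by (auto dest: permutations_of_setD)
  have len: "length xs = n" using distinct_card[OF s(2)] s(1) by simp
  have "inj_on (\<lambda>i. int (xs ! i)) {..<n}"
    using inj_on_nth[OF s(2)] len by (auto simp: inj_on_def)
  moreover have "xs ! j \<le> prefix_max xs i" if "i < j" "j < n" "int (xs ! j) < int (xs ! i)" for i j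
    using that prefix_max_ge[of i i xs] len by simp
  ultimately have *: "2 * (\<Sum>j<n. \<Sum>i<j. if xs ! j \<le> prefix_max xs i then int (xs ! j) - int (xs ! i) else 0)
      - (\<Sum>j<n. \<Sum>i<j. int (xs ! j) - int (xs ! i))
      + (\<Sum>j<n. \<Sum>i<j. \<bar>int (xs ! j) - int (xs ! i)\<bar>) = 0
    \<longleftrightarrow> (\<forall>i j. i < j \<longrightarrow> j < n \<longrightarrow> xs ! j \<le> prefix_max xs i \<longrightarrow> int (xs ! j) < int (xs ! i))"
    by (rule pair_weight_eq_0_iff)
  have F: "post_weight xs = 2 * (\<Sum>j<n. \<Sum>i<j. if xs ! j \<le> prefix_max xs i then int (xs ! j) - int (xs ! i) else 0)
      - (\<Sum>j<n. \<Sum>i<j. int (xs ! j) - int (xs ! i))"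
  proof -
    have "post_weight xs =
      (\<Sum>i<n. 2 * (\<Sum>j\<in>{i<..<n}. if xs ! j \<le> prefix_max xs i then int (xs ! j) - int (xs ! i) else 0) -
        (int i * int (xs ! i) - (\<Sum>k<i. int (xs ! k))))"
      unfolding post_weight_def len
      by (intro sum.cong refl)
        (use post_active_sum[OF xs] in \<open>simp add: post_term_def lessThan_Suc_atMost[symmetric]\<close>)
    then show ?thesis
      unfolding sum_pairs_swap[of "\<lambda>i j. if xs ! j \<le> prefix_max xs i then int (xs ! j) - int (xs ! i) else 0"]
        sum_pairs_diff by (simp only: sum_subtractf sum_distrib_left[symmetric])
  qed
  have e: "2 * post_weight xs + total_distance n =
      2 * (post_weight xs + (\<Sum>j<n. \<Sum>i<j. \<bar>int (xs ! j) - int (xs ! i)\<bar>))"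
    using sum_distance_permutation[OF xs] by simp
  have "2 * post_weight xs + total_distance n = 0 \<longleftrightarrow>
      (\<forall>i j. i < j \<longrightarrow> j < n \<longrightarrow> xs ! j \<le> prefix_max xs i \<longrightarrow> xs ! j < xs ! i)"
    unfolding e
    using *[folded F] by (simp del: distrib_left_numeral)
  also have "\<dots> \<longleftrightarrow> avoids_231_wrt (>) (rev xs)"
    unfolding avoids_231_rev_iff len
  proof (intro iffI allI impI notI)
    fix i j k
    assume a: "\<forall>i j. i < j \<longrightarrow> j < n \<longrightarrow> xs ! j \<le> prefix_max xs i \<longrightarrow> xs ! j < xs ! i"
      and *: "i < j" "j < k" "k < n" "xs ! j < xs ! k \<and> xs ! k < xs ! i"
    have "xs ! k \<le> prefix_max xs j" using prefix_max_ge[of i j xs] * len by simp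
    with a * show False by fastforce
  next
    fix i k
    assume a: "\<forall>i j k. i < j \<longrightarrow> j < k \<longrightarrow> k < n \<longrightarrow> \<not> (xs ! j < xs ! k \<and> xs ! k < xs ! i)"
      and *: "i < k" "k < n" "xs ! k \<le> prefix_max xs i"
    obtain l where l: "l \<le> i" "prefix_max xs i = xs ! l" using prefix_max_attained[of i xs] * len by auto
    have ne: "xs ! k \<noteq> xs ! i" "xs ! k \<noteq> xs ! l"
      using s(2) len * l by (auto simp: nth_eq_iff_index_eq)
    show "xs ! k < xs ! i"
    proof (rule ccontr)
      assume "\<not> ?thesis"
      then have "xs ! i < xs ! k" "xs ! k < xs ! l" using ne * l by auto
      moreover from this have "l < i" using l by (cases "l = i") auto
      ultimately show False using a * by blast
    qed
  qed
  finally show ?thesis .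
qed

text \<open>A 231 at \<open>i < j < k\<close> makes \<open>(i, j)\<close> an active non-inversion,
  since the suffix minimum at \<open>j\<close> is at most \<open>xs ! k\<close>. Conversely, the
  position of the suffix minimum supplies the 1.\<close>

lemma pre_weight_correct:
  assumes xs: "xs \<in> permutations_of_set {1..n}"
  shows "2 * pre_weight xs + total_distance n = 0 \<longleftrightarrow> avoids_231_wrt (<) xs"
proof -
  have s: "set xs = {1..n}" "distinct xs" using xs by (auto dest: permutations_of_setD)
  have len: "length xs = n" using distinct_card[OF s(2)] s(1) by simp
  have "inj_on (\<lambda>i. int (xs ! i)) {..<n}"
    using inj_on_nth[OF s(2)] len by (auto simp: inj_on_def)
  moreover have "suffix_min xs j \<le> xs ! i" if "i < j" "j < n" "int (xs ! j) < int (xs ! i)" for i j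
    using that suffix_min_le[of j j xs] len by simp
  ultimately have *: "2 * (\<Sum>j<n. \<Sum>i<j. if suffix_min xs j \<le> xs ! i then int (xs ! j) - int (xs ! i) else 0)
      - (\<Sum>j<n. \<Sum>i<j. int (xs ! j) - int (xs ! i))
      + (\<Sum>j<n. \<Sum>i<j. \<bar>int (xs ! j) - int (xs ! i)\<bar>) = 0
    \<longleftrightarrow> (\<forall>i j. i < j \<longrightarrow> j < n \<longrightarrow> suffix_min xs j \<le> xs ! i \<longrightarrow> int (xs ! j) < int (xs ! i))"
    by (rule pair_weight_eq_0_iff)
  have F: "pre_weight xs = 2 * (\<Sum>j<n. \<Sum>i<j. if suffix_min xs j \<le> xs ! i then int (xs ! j) - int (xs ! i) else 0)
      - (\<Sum>j<n. \<Sum>i<j. int (xs ! j) - int (xs ! i))"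
  proof -
    have "pre_weight xs =
      (\<Sum>j<n. 2 * (\<Sum>i<j. if suffix_min xs j \<le> xs ! i then int (xs ! j) - int (xs ! i) else 0) -
        (int j * int (xs ! j) - (\<Sum>k<j. int (xs ! k))))"
      unfolding pre_weight_def len
      by (intro sum.cong refl) (use pre_active_sum[OF xs] in \<open>simp add: pre_term_def\<close>)
    then show ?thesis
      unfolding sum_pairs_diff by (simp only: sum_subtractf sum_distrib_left[symmetric])
  qed
  have e: "2 * pre_weight xs + total_distance n =
      2 * (pre_weight xs + (\<Sum>j<n. \<Sum>i<j. \<bar>int (xs ! j) - int (xs ! i)\<bar>))"
    using sum_distance_permutation[OF xs] by simp
  have "2 * pre_weight xs + total_distance n = 0 \<longleftrightarrow>
      (\<forall>i j. i < j \<longrightarrow> j < n \<longrightarrow> suffix_min xs j \<le> xs ! i \<longrightarrow> xs ! j < xs ! i)"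
    unfolding e
    using *[folded F] by (simp del: distrib_left_numeral)
  also have "\<dots> \<longleftrightarrow> avoids_231_wrt (<) xs"
    unfolding avoids_231_wrt_def len
  proof (intro iffI allI impI notI)
    fix i j k
    assume a: "\<forall>i j. i < j \<longrightarrow> j < n \<longrightarrow> suffix_min xs j \<le> xs ! i \<longrightarrow> xs ! j < xs ! i"
      and *: "i < j" "j < k" "k < n" "xs ! k < xs ! i \<and> xs ! i < xs ! j"
    have "suffix_min xs j \<le> xs ! i" using suffix_min_le[of j k xs] * len by simp
    with a * show False by fastforce
  next
    fix i j
    assume a: "\<forall>i j k. i < j \<longrightarrow> j < k \<longrightarrow> k < n \<longrightarrow> \<not> (xs ! k < xs ! i \<and> xs ! i < xs ! j)"
      and *: "i < j" "j < n" "suffix_min xs j \<le> xs ! i"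
    obtain l where l: "j \<le> l" "l < n" "suffix_min xs j = xs ! l" using suffix_min_attained[of j xs] * len by auto
    have ne: "xs ! j \<noteq> xs ! i" "xs ! i \<noteq> xs ! l"
      using s(2) len * l by (auto simp: nth_eq_iff_index_eq)
    show "xs ! j < xs ! i"
    proof (rule ccontr)
      assume "\<not> ?thesis"
      then have "xs ! i < xs ! j" "xs ! l < xs ! i" using ne * l by auto
      moreover from this have "j < l" using l by (cases "l = j") auto
      ultimately show False using a * l by blast
    qed
  qed
  finally show ?thesis .
qed

section \<open>Size bounds for the counters\<close>

text \<open>The cube is dictated by the weight, a sum of at most \<open>n\<close> terms of absolute
  value at most \<open>7 * (n + 1) ^ 2\<close>. The smaller counters share the same box.\<close>

definition range_box :: "nat \<Rightarrow> int set" where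
  "range_box n = {- 7 * (int n + 1) ^ 3 .. 7 * (int n + 1) ^ 3}"

lemma finite_range_box [simp]: "finite (range_box n)"
  by (simp add: range_box_def)

lemma card_range_box: "card (range_box n) \<le> 15 * (n + 1) ^ 3"
proof -
  have "int (card (range_box n)) = 14 * (int n + 1) ^ 3 + 1"
    by (simp add: range_box_def)
  also have "\<dots> \<le> 15 * (int n + 1) ^ 3" by simp
  also have "\<dots> = int (15 * (n + 1) ^ 3)" by (simp add: add.commute)
  finally show ?thesis by linarith
qed

lemma range_boxI: "\<bar>z\<bar> \<le> 7 * (int n + 1) ^ 3 \<Longrightarrow> z \<in> range_box n"
  by (auto simp: range_box_def)

lemma range_boxI_square:
  assumes "0 \<le> z" "z \<le> (int n + 1) ^ 2"
  shows "z \<in> range_box n"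
proof -
  have "(int n + 1) ^ 2 \<le> (int n + 1) ^ 3" by (rule power_increasing) auto
  then show ?thesis using assms by (intro range_boxI) simp
qed

lemma range_boxI_linear:
  assumes "0 \<le> z" "z \<le> int n"
  shows "z \<in> range_box n"
proof -
  have "(int n + 1) ^ 1 \<le> (int n + 1) ^ 2" by (rule power_increasing) auto
  then show ?thesis using assms by (intro range_boxI_square) auto
qed

context
  fixes n :: nat and ys :: "nat list"
  assumes ys: "distinct ys" "set ys \<subseteq> {1..n}"
begin

lemma length_le: "length ys \<le> n"
  using card_mono[OF _ ys(2)] distinct_card[OF ys(1)] by simp

lemma nth_bounds: "k < length ys \<Longrightarrow> 0 \<le> int (ys ! k) \<and> int (ys ! k) \<le> int n"
  using ys(2) nth_mem[of k ys] by fastforce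

lemma sum_nth_bounds:
  assumes "A \<subseteq> {..<length ys}"
  shows "0 \<le> (\<Sum>k\<in>A. int (ys ! k)) \<and> (\<Sum>k\<in>A. int (ys ! k)) \<le> (int n + 1) ^ 2"
proof -
  have "card A \<le> n" using card_mono[OF _ assms] length_le by simp
  have "(\<Sum>k\<in>A. int (ys ! k)) \<le> of_nat (card A) * int n"
    by (rule sum_bounded_above) (use assms nth_bounds in auto)
  also have "\<dots> \<le> (int n + 1) * (int n + 1)"
    using \<open>card A \<le> n\<close> by (intro mult_mono) auto
  finally show ?thesis by (simp add: power2_eq_square sum_nonneg)
qed

lemma suffix_min_bounds: "j < length ys \<Longrightarrow> 0 \<le> int (suffix_min ys j) \<and> int (suffix_min ys j) \<le> int n"
  using suffix_min_attained[of j ys] nth_bounds by force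

lemma prefix_max_bounds: "i < length ys \<Longrightarrow> 0 \<le> int (prefix_max ys i) \<and> int (prefix_max ys i) \<le> int n"
  using prefix_max_attained[of i ys] nth_bounds by fastforce

end

lemma abs_mult_le_square:
  fixes a b N :: int
  assumes "\<bar>a\<bar> \<le> N" "\<bar>b\<bar> \<le> N"
  shows "\<bar>a * b\<bar> \<le> N ^ 2"
  unfolding abs_mult power2_eq_square using assms by (intro mult_mono) auto

lemma post_term_bound:
  assumes "0 \<le> t" "t \<le> int n" "0 \<le> P" "P \<le> (int n + 1) ^ 2" "0 \<le> M" "M \<le> int n" "0 \<le> x" "x \<le> int n"
  shows "\<bar>post_term t P M x\<bar> \<le> 7 * (int n + 1) ^ 2"
proof -
  \<comment> \<open>With the products as atoms the claim becomes linear; \<open>x * 1\<close> puts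
    the linear term under the same square bound.\<close>
  have "\<bar>M * (M + 1)\<bar> \<le> (int n + 1) ^ 2" "\<bar>(M - t - 1) * x\<bar> \<le> (int n + 1) ^ 2"
       "\<bar>t * x\<bar> \<le> (int n + 1) ^ 2" "\<bar>x * 1\<bar> \<le> (int n + 1) ^ 2"
    using assms by (intro abs_mult_le_square; linarith)+
  moreover have "0 \<le> M * (M + 1)" "0 \<le> t * x" using assms by auto
  moreover have "post_term t P M x = M * (M + 1) - P - 2 * x - 2 * ((M - t - 1) * x) - t * x"
    by (simp add: post_term_def algebra_simps)
  ultimately show ?thesis using assms by linarith
qed

lemma pre_term_bound:
  assumes "0 \<le> t" "t \<le> int n" "0 \<le> P" "P \<le> (int n + 1) ^ 2" "0 \<le> m" "m \<le> int n" "0 \<le> x" "x \<le> int n"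
  shows "\<bar>pre_term t P m x\<bar> \<le> 7 * (int n + 1) ^ 2"
proof -
  have "\<bar>m * (m - 1)\<bar> \<le> (int n + 1) ^ 2" "\<bar>(t - m + 1) * x\<bar> \<le> (int n + 1) ^ 2"
       "\<bar>t * x\<bar> \<le> (int n + 1) ^ 2"
    using assms by (intro abs_mult_le_square; linarith)+
  moreover have "pre_term t P m x = m * (m - 1) - P + 2 * ((t - m + 1) * x) - t * x"
    by (simp add: pre_term_def algebra_simps)
  ultimately show ?thesis using assms by linarith
qed

lemma sum_range_box:
  fixes g :: "nat \<Rightarrow> int"
  assumes "l \<le> n" "\<And>i. i < l \<Longrightarrow> \<bar>g i\<bar> \<le> 7 * (int n + 1) ^ 2"
  shows "(\<Sum>i<l. g i) \<in> range_box n"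
proof (rule range_boxI)
  have "\<bar>\<Sum>i<l. g i\<bar> \<le> (\<Sum>i<l. \<bar>g i\<bar>)" by (rule sum_abs)
  also have "\<dots> \<le> of_nat (card {..<l}) * (7 * (int n + 1) ^ 2)"
    by (rule sum_bounded_above) (use assms in auto)
  also have "\<dots> \<le> (int n + 1) * (7 * (int n + 1) ^ 2)"
    using assms(1) by (intro mult_right_mono) auto
  finally show "\<bar>\<Sum>i<l. g i\<bar> \<le> 7 * (int n + 1) ^ 3"
    by (simp add: power3_eq_cube power2_eq_square)
qed

lemma post_weight_range_box:
  assumes ys: "distinct ys" "set ys \<subseteq> {1..n}"
  shows "post_weight ys \<in> range_box n"
  unfolding post_weight_def
  using length_le[OF ys] nth_bounds[OF ys] sum_nth_bounds[OF ys, of "{..<_}"] prefix_max_bounds[OF ys]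
  by (intro sum_range_box post_term_bound) auto

lemma pre_weight_range_box:
  assumes ys: "distinct ys" "set ys \<subseteq> {1..n}"
  shows "pre_weight ys \<in> range_box n"
  unfolding pre_weight_def
  using length_le[OF ys] nth_bounds[OF ys] sum_nth_bounds[OF ys, of "{..<_}"] suffix_min_bounds[OF ys]
  by (intro sum_range_box pre_term_bound) auto

section \<open>The postorder automaton\<close>

lemma sum_nth_append:
  "i \<le> length ys \<Longrightarrow> (\<Sum>k<i. int ((ys @ zs) ! k)) = (\<Sum>k<i. int (ys ! k))"
  by (intro sum.cong refl) (auto simp: nth_append)

lemma prefix_max_append: "i < length ys \<Longrightarrow> prefix_max (ys @ zs) i = prefix_max ys i"
  by (simp add: prefix_max_def)

lemma suffix_min_snoc: "j < length ys \<Longrightarrow> suffix_min (ys @ [x]) j = min (suffix_min ys j) x"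
  by (simp add: suffix_min_def min.commute)

lemma suffix_min_snoc_last: "suffix_min (ys @ [x]) (length ys) = x"
  by (simp add: suffix_min_def)

text \<open>A state holds the number, sum, maximum and weight of the values read. The maximum is
  updated first because a prefix maximum includes the current position.\<close>

fun post_step :: "int \<times> int \<times> int \<times> int \<Rightarrow> nat \<Rightarrow> int \<times> int \<times> int \<times> int" where
  "post_step (t, P, M, F) x =
     (t + 1, P + int x, max M (int x), F + post_term t P (max M (int x)) (int x))"

definition post_state :: "nat list \<Rightarrow> int \<times> int \<times> int \<times> int" where
  "post_state ys = (int (length ys), \<Sum>k<length ys. int (ys ! k), int (Max (insert 0 (set ys))), post_weight ys)"

text \<open>Later values do not affect earlier prefix maxima, so a new value only adds its own term
  to the weight.\<close>

lemma post_state_snoc: "post_state (ys @ [x]) = post_step (post_state ys) x"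
proof -
  have M: "int (Max (insert 0 (set (ys @ [x])))) = max (int (Max (insert 0 (set ys)))) (int x)"
    by (simp add: insert_commute[of 0 x] max.commute)
  have "prefix_max (ys @ [x]) (length ys) = Max (insert 0 (set (ys @ [x])))"
    using Max_insert[of "set (ys @ [x])" 0] by (simp add: prefix_max_def)
  then have "post_weight (ys @ [x]) = post_weight ys +
      post_term (length ys) (\<Sum>k<length ys. int (ys ! k)) (int (Max (insert 0 (set (ys @ [x]))))) (int x)"
    unfolding post_weight_def by (simp add: sum_nth_append prefix_max_append nth_append del: set_append)
  then show ?thesis
    using M by (simp add: post_state_def sum_nth_append)
qed

lemma postorder_decidable:
  "\<exists>s :: nat \<Rightarrow> nat. (\<lambda>n. real (s n)) \<in> O(\<lambda>n. log 2 (real n)) \<and>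
     one_pass_decidable is_bst_postorder s"
proof (rule one_pass_decidableI)
  let ?S = "\<lambda>n. range_box n \<times> range_box n \<times> range_box n \<times> range_box n"
  let ?Inv = "\<lambda>(n :: nat) ys q. q = post_state ys"
  show "finite (?S n)" for n by simp
  show "card (?S n) \<le> 15 ^ 4 * (n + 1) ^ 12" for n
  proof -
    have "card (?S n) = card (range_box n) ^ 4"
      by (simp add: card_cartesian_product eval_nat_numeral)
    also have "\<dots> \<le> (15 * (n + 1) ^ 3) ^ 4"
      by (intro power_mono card_range_box) simp
    finally show ?thesis by (simp only: power_mult_distrib power_mult[symmetric]) simp
  qed
  show "q \<in> ?S n" if "?Inv n ys q" and ys: "distinct ys" "set ys \<subseteq> {1..n}" for n ys q
  proof -
    have "Max (insert 0 (set ys)) \<le> n" using ys(2) by auto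
    then show ?thesis
      unfolding that(1) post_state_def
      using length_le[OF ys] sum_nth_bounds[OF ys order_refl] post_weight_range_box[OF ys]
      by (auto intro: range_boxI_linear range_boxI_square)
  qed
  show "?Inv n [] (0, 0, 0, 0)" for n by (simp add: post_state_def post_weight_def)
  show "?Inv n (ys @ [x]) (post_step q x)" if "?Inv n ys q" for n ys q x
    using that by (simp add: post_state_snoc)
  show "(case q of (t, P, M, F) \<Rightarrow> 2 * F + total_distance n = 0) \<longleftrightarrow> is_bst_postorder n xs"
    if "?Inv n xs q" "xs \<in> permutations_of_set {1..n}" for n xs q
    using that post_weight_correct[OF that(2)] is_bst_postorder_iff[OF that(2)] by (simp add: post_state_def)
qed

section \<open>The preorder automaton\<close>

text \<open>
  In a state \<open>(t, P, y, R, Q, b, F)\<close>, \<open>y\<close> is the last value, \<open>R\<close> and \<open>Q\<close> are the number and the sum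
  of the values in the current descending run (the positions with suffix minimum \<open>y\<close>), \<open>b\<close> is the
  bottom of the previous run, and \<open>F\<close> is the weight computed as if the stream ended here; hence
  the correction of the whole run when \<open>y\<close> is undercut. \<^term>\<open>None\<close> means that a 231 has been seen.
\<close>

type_synonym pre_state = "int \<times> int \<times> int \<times> int \<times> int \<times> int \<times> int"

fun pre_step :: "pre_state option \<Rightarrow> nat \<Rightarrow> pre_state option" where
  "pre_step None x = None"
| "pre_step (Some (t, P, y, R, Q, b, F)) x =
     (let x = int x in
      if y < x then Some (t + 1, P + x, x, 1, x, y, F + pre_term t P x x)
      else if b < x then
        Some (t + 1, P + x, x, R + 1, Q + x, b,
              F + ((x * (x - 1) - y * (y - 1)) * R - 2 * (x - y) * Q) + pre_term t P x x)
      else None)"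

definition min_class :: "nat list \<Rightarrow> int \<Rightarrow> nat set" where
  "min_class ys y = {j. j < length ys \<and> int (suffix_min ys j) = y}"

text \<open>The default 0 makes the first value, being positive, count as an ascent.\<close>

definition bottom :: "nat list \<Rightarrow> int" where
  "bottom ys = (if ys = [] then 0 else int (last ys))"

text \<open>On positive entries \<open>b\<close> is the largest suffix minimum other than
  \<open>y\<close>, or 0 if there is none. That it is attained provides the 231 on
  rejection.\<close>

fun pre_inv :: "nat list \<Rightarrow> pre_state option \<Rightarrow> bool" where
  "pre_inv ys None \<longleftrightarrow> \<not> avoids_231_wrt (<) ys"
| "pre_inv ys (Some (t, P, y, R, Q, b, F)) \<longleftrightarrow>
     t = int (length ys) \<and> P = (\<Sum>k<length ys. int (ys ! k)) \<and> y = bottom ys \<and>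
     R = int (card (min_class ys y)) \<and> Q = (\<Sum>j\<in>min_class ys y. int (ys ! j)) \<and>
     (\<forall>j<length ys. int (suffix_min ys j) \<noteq> y \<longrightarrow> int (suffix_min ys j) \<le> b) \<and>
     (b = 0 \<or> (b < y \<and> (\<exists>j<length ys. int (suffix_min ys j) = b))) \<and>
     F = pre_weight ys"

lemma avoids_231_wrt_appendD: "avoids_231_wrt R (xs @ ys) \<Longrightarrow> avoids_231_wrt R xs"
  using avoids_231_rec_append by (auto simp flip: avoids_231_rec_iff)

lemma suffix_min_le_bottom: "j < length ys \<Longrightarrow> int (suffix_min ys j) \<le> bottom ys"
  using suffix_min_le[of j "length ys - 1" ys] by (auto simp: bottom_def last_conv_nth)

text \<open>Suffix minima of old positions may drop when a value arrives, so the old terms are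
  re-evaluated at their new minima.\<close>

lemma pre_weight_snoc:
  "pre_weight (ys @ [x]) =
     (\<Sum>j<length ys. pre_term j (\<Sum>k<j. int (ys ! k)) (suffix_min (ys @ [x]) j) (int (ys ! j)))
     + pre_term (length ys) (\<Sum>k<length ys. int (ys ! k)) x x"
  unfolding pre_weight_def by (simp add: sum_nth_append suffix_min_snoc_last nth_append)

text \<open>An ascent keeps all suffix minima and opens a new run. A descent staying above
  \<open>b\<close> lowers the minimum exactly on the current run. A descent below \<open>b\<close>
  completes a 231.\<close>

lemma pre_inv_step:
  assumes inv: "pre_inv ys q" and ys: "distinct (ys @ [x])" "0 < x"
  shows "pre_inv (ys @ [x]) (pre_step q x)"
proof (cases q)
  case None
  then show ?thesis using inv avoids_231_wrt_appendD[of _ ys "[x]"] by auto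
next
  case (Some s)
  obtain t P y R Q b F where s: "s = (t, P, y, R, Q, b, F)" by (cases s)
  define X where "X = int x"
  have t: "t = int (length ys)" and P: "P = (\<Sum>k<length ys. int (ys ! k))" and y: "y = bottom ys"
    and R: "R = int (card (min_class ys y))" and Q: "Q = (\<Sum>j\<in>min_class ys y. int (ys ! j))"
    and b: "\<And>j. j < length ys \<Longrightarrow> int (suffix_min ys j) \<noteq> y \<Longrightarrow> int (suffix_min ys j) \<le> b"
    and b': "b = 0 \<or> (b < y \<and> (\<exists>j<length ys. int (suffix_min ys j) = b))"
    and F: "F = pre_weight ys"
    using inv Some s by auto
  have le_y: "int (suffix_min ys j) \<le> y" if "j < length ys" for j
    using suffix_min_le_bottom[OF that] y by simp
  have bot: "bottom (ys @ [x]) = X" by (simp add: bottom_def X_def)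
  have P': "(\<Sum>k<length (ys @ [x]). int ((ys @ [x]) ! k)) = P + X"
    using P by (simp add: sum_nth_append X_def)
  have snoc: "int (suffix_min (ys @ [x]) j) = min (int (suffix_min ys j)) X" if "j < length ys" for j
    using suffix_min_snoc[OF that] by (simp add: X_def)
  have last: "int (suffix_min (ys @ [x]) (length ys)) = X" by (simp add: suffix_min_snoc_last X_def)
  consider (up) "y < X" | (down) "\<not> y < X" "b < X" | (bad) "\<not> y < X" "\<not> b < X" by blast
  then show ?thesis
  proof cases
    case up
    have same: "int (suffix_min (ys @ [x]) j) = int (suffix_min ys j)" if "j < length ys" for j
      using snoc[OF that] le_y[OF that] up by simp
    have cls: "min_class (ys @ [x]) X = {length ys}"
      using same le_y up last by (fastforce simp: min_class_def less_Suc_eq)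
    have "pre_weight (ys @ [x]) = F + pre_term t P X X"
      unfolding pre_weight_snoc F using same by (simp add: t P X_def pre_weight_def)
    \<comment> \<open>The bottom of the finished run becomes the new \<open>b\<close>; it is the
      suffix minimum at its own position.\<close>
    moreover have "y = 0 \<or> (\<exists>j<length (ys @ [x]). int (suffix_min (ys @ [x]) j) = y)"
    proof (cases "ys = []")
      case False
      then have "int (suffix_min ys (length ys - 1)) = y"
        using y by (simp add: bottom_def suffix_min_def drop_Cons' last_conv_nth Cons_nth_drop_Suc[symmetric])
      then show ?thesis using False same[of "length ys - 1"]
        by (intro disjI2 exI[of _ "length ys - 1"]) auto
    qed (simp add: y bottom_def)
    moreover have "int (suffix_min (ys @ [x]) j) \<le> y"
      if "j < length (ys @ [x])" "int (suffix_min (ys @ [x]) j) \<noteq> X" for j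
      using that same last le_y by (cases "j = length ys") auto
    ultimately show ?thesis
      using up P' cls bot by (simp add: Some s Let_def t flip: X_def)
  next
    case down
    have ne: "ys \<noteq> []" using down(1) ys(2) y by (auto simp: bottom_def X_def)
    have "X \<noteq> y" using ne ys(1) y by (auto simp: bottom_def X_def)
    then have Xy: "X < y" using down by simp
    \<comment> \<open>Minima other than \<open>y\<close> are at most \<open>b\<close>, hence below
      \<open>X\<close>, and do not change.\<close>
    have m: "int (suffix_min (ys @ [x]) j) = (if int (suffix_min ys j) = y then X else int (suffix_min ys j))"
      if "j < length ys" for j
      using snoc[OF that] b[OF that] Xy down(2) by auto
    have cls: "min_class (ys @ [x]) X = insert (length ys) (min_class ys y)"
    proof -
      have "int (suffix_min ys j) \<noteq> X" if "j < length ys" for j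
        using b[OF that] down(2) Xy by force
      then show ?thesis using m last by (auto simp: min_class_def less_Suc_eq split: if_splits)
    qed
    have fin: "finite (min_class ys y)" "length ys \<notin> min_class ys y"
      by (auto simp: min_class_def)
    \<comment> \<open>At a value \<open>v\<close>, \<open>pre_term\<close> depends on the minimum
      \<open>m\<close> through \<open>m * (m - 1) - 2 * m * v\<close>, so the count \<open>R\<close>
      and the sum \<open>Q\<close> of the run determine the correction.\<close>
    have "(\<Sum>j<length ys. pre_term j (\<Sum>k<j. int (ys ! k)) (suffix_min (ys @ [x]) j) (int (ys ! j))) - pre_weight ys
      = (\<Sum>j<length ys. if int (suffix_min ys j) = y then (X * (X - 1) - y * (y - 1)) - 2 * (X - y) * int (ys ! j) else 0)"
      unfolding pre_weight_def sum_subtractf[symmetric]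
      by (intro sum.cong refl) (simp add: m pre_term_def algebra_simps)
    also have "\<dots> = (\<Sum>j\<in>min_class ys y. (X * (X - 1) - y * (y - 1)) - 2 * (X - y) * int (ys ! j))"
      by (subst sum.inter_filter[symmetric]) (auto simp: min_class_def intro!: sum.cong)
    also have "\<dots> = (X * (X - 1) - y * (y - 1)) * R - 2 * (X - y) * Q"
      by (simp add: R Q sum_subtractf sum_distrib_left)
    finally have "pre_weight (ys @ [x]) =
        F + ((X * (X - 1) - y * (y - 1)) * R - 2 * (X - y) * Q) + pre_term t P X X"
      unfolding pre_weight_snoc by (simp add: F t P X_def)
    moreover have "(\<Sum>j\<in>min_class (ys @ [x]) X. int ((ys @ [x]) ! j)) = Q + X"
    proof -
      have "(\<Sum>j\<in>min_class ys y. int ((ys @ [x]) ! j)) = Q"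
        unfolding Q by (intro sum.cong refl) (auto simp: min_class_def nth_append)
      then show ?thesis unfolding cls using fin by (simp add: X_def)
    qed
    moreover have "int (card (min_class (ys @ [x]) X)) = R + 1"
      using fin by (simp add: cls R)
    moreover have "int (suffix_min (ys @ [x]) j) \<le> b"
      if "j < length (ys @ [x])" "int (suffix_min (ys @ [x]) j) \<noteq> X" for j
      using that m b last by (cases "j = length ys") (auto split: if_splits)
    moreover have "b = 0 \<or> (b < X \<and> (\<exists>j<length (ys @ [x]). int (suffix_min (ys @ [x]) j) = b))"
      using b' m down(2) by (auto simp: less_Suc_eq)
    ultimately show ?thesis
      using down P' bot by (simp add: Some s Let_def t flip: X_def)
  next
    case bad
    have ne: "ys \<noteq> []" using bad(1) ys(2) y by (auto simp: bottom_def X_def)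
    have "b \<noteq> 0" using bad(2) ys(2) by (auto simp: X_def)
    then obtain j where j: "j < length ys" "int (suffix_min ys j) = b" "b < y" using b' by auto
    \<comment> \<open>Position \<open>k\<close> carries the 2 with value \<open>b\<close>, the last
      old position the 3 with value \<open>y\<close>, and \<open>x\<close> is the 1.\<close>
    obtain k where k: "k < length ys" "int (ys ! k) = b" using suffix_min_attained[OF j(1)] j(2) by auto
    have y_last: "y = int (ys ! (length ys - 1))" using ne y by (simp add: bottom_def last_conv_nth)
    then have "k \<noteq> length ys - 1" using k j by auto
    then have "k < length ys - 1" using k by simp
    moreover have "x \<noteq> ys ! k" using ys(1) k(1) by auto
    then have "x < ys ! k" using bad(2) k(2) by (simp add: X_def)
    moreover have "ys ! k < ys ! (length ys - 1)" using k(2) j(3) y_last by simp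
    ultimately have "\<not> avoids_231_wrt (<) (ys @ [x])"
      using k(1) unfolding avoids_231_wrt_def not_all
      by (intro exI[of _ k] exI[of _ "length ys - 1"] exI[of _ "length ys"]) (simp add: nth_append)
    then show ?thesis using bad by (simp add: Some s flip: X_def)
  qed
qed

lemma preorder_decidable:
  "\<exists>s :: nat \<Rightarrow> nat. (\<lambda>n. real (s n)) \<in> O(\<lambda>n. log 2 (real n)) \<and>
     one_pass_decidable is_bst_preorder s"
proof (rule one_pass_decidableI)
  let ?B = "\<lambda>n. range_box n \<times> range_box n \<times> range_box n \<times> range_box n \<times> range_box n \<times> range_box n \<times> range_box n"
  let ?S = "\<lambda>n. insert None (Some ` ?B n)"
  let ?Inv = "\<lambda>(n :: nat) ys q. pre_inv ys q"
  show "finite (?S n)" for n by simp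
  show "card (?S n) \<le> 16 ^ 7 * (n + 1) ^ 21" for n
  proof -
    have "card (?S n) = card (range_box n) ^ 7 + 1"
      by (subst card_insert_disjoint)
        (auto simp: card_image card_cartesian_product eval_nat_numeral)
    also have "\<dots> \<le> (15 * (n + 1) ^ 3) ^ 7 + 1"
      by (intro add_right_mono power_mono card_range_box) simp
    also have "\<dots> = 15 ^ 7 * (n + 1) ^ 21 + 1"
      by (simp only: power_mult_distrib power_mult[symmetric]) simp
    also have "\<dots> \<le> 16 ^ 7 * (n + 1) ^ 21"
      using one_le_power[of "n + 1" 21] by simp
    finally show ?thesis .
  qed
  show "q \<in> ?S n" if q: "?Inv n ys q" and ys: "distinct ys" "set ys \<subseteq> {1..n}" for n ys q
  proof (cases q)
    case (Some s)
    obtain t P y R Q b F where s: "s = (t, P, y, R, Q, b, F)" by (cases s)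
    have sub: "min_class ys y \<subseteq> {..<length ys}" by (auto simp: min_class_def)
    have "card (min_class ys y) \<le> n"
      using card_mono[OF _ sub] length_le[OF ys] by simp
    moreover have "0 \<le> bottom ys \<and> bottom ys \<le> int n"
      using ys(2) last_in_set[of ys] by (force simp: bottom_def)
    moreover have "0 \<le> b \<and> b \<le> int n"
      using q Some s suffix_min_bounds[OF ys] by auto
    ultimately have "t \<in> range_box n" "P \<in> range_box n" "y \<in> range_box n" "R \<in> range_box n"
      "Q \<in> range_box n" "b \<in> range_box n" "F \<in> range_box n"
      using q Some s length_le[OF ys] sum_nth_bounds[OF ys order_refl] sum_nth_bounds[OF ys sub]
        pre_weight_range_box[OF ys]
      by (auto intro: range_boxI_linear range_boxI_square)
    then show ?thesis using Some s by simp
  qed simp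
  show "?Inv n [] (Some (0, 0, 0, 0, 0, 0, 0))" for n
    by (simp add: bottom_def min_class_def pre_weight_def)
  show "?Inv n (ys @ [x]) (pre_step q x)"
    if "?Inv n ys q" "distinct (ys @ [x])" "set (ys @ [x]) \<subseteq> {1..n}" for n ys q x
    using that by (intro pre_inv_step) auto
  \<comment> \<open>After the last value the provisional weight is the true one; \<open>None\<close>
    answers negatively because a 231 has occurred.\<close>
  show "(case q of None \<Rightarrow> False | Some (t, P, y, R, Q, b, F) \<Rightarrow> 2 * F + total_distance n = 0)
      \<longleftrightarrow> is_bst_preorder n xs"
    if "?Inv n xs q" "xs \<in> permutations_of_set {1..n}" for n xs q
    using that(1) pre_weight_correct[OF that(2)] is_bst_preorder_iff[OF that(2)]
    by (auto split: option.splits)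
qed

theorem corollary1p3:
  shows "(\<exists>s :: nat \<Rightarrow> nat. (\<lambda>n. real (s n)) \<in> O(\<lambda>n. log 2 (real n)) \<and>
            one_pass_decidable is_bst_preorder s) \<and>
         (\<exists>s :: nat \<Rightarrow> nat. (\<lambda>n. real (s n)) \<in> O(\<lambda>n. log 2 (real n)) \<and>
            one_pass_decidable is_bst_postorder s)"
  using preorder_decidable postorder_decidable by blast

end
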